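(* Let $P$ be a poset with a regular weight function $\mathrm{wt}:P\to\mathbb{Z}[[\mathbf{x}]]$, and let $u\in P^*$. Suppose that for any two subwords $y$ and $z$ of $u$ the series $$\sum_{a\in P:\ a\ge y,\ a\not\ge z}\mathrm{wt}(a)$$ is a rational function. Then $F(u;\mathbf{x})$, $S(u;\mathbf{x})$, and $A(u;\mathbf{x})$ are rational functions.
   Context: $\mathbf{x}=\{x_1,\ldots,x_m\}$ are commuting variables. A function $\mathrm{wt}:P\to\mathbb{Z}[[\mathbf{x}]]$ is extended to words by $\mathrm{wt}(w_1\cdots w_\ell)=\prod_i\mathrm{wt}(w_i)$, and is called regular if only finitely many words $w\in P^*$ have any given weight. Generalized factor order on $P^*$: $u\le w$ iff there is a factor $w'$ of $w$ (consecutive letters) with $|w'|=|u|$ and $u_i\le w'_i$ for all $i$; such $w'$ is an embedding. $\mathcal{F}(u)=\{w:w\ge u\}$; $\mathcal{S}(u)$ is the set of $w\in\mathcal{F}(u)$ for which every embedding of $u$ into $w$ is a suffix of $w$; $\mathcal{A}(u)=\{w:w\not\ge u\}$. $F(u;\mathbf{x}),S(u;\mathbf{x}),A(u;\mathbf{x})$ are the sums of $\mathrm{wt}(w)$ over these languages. For a subword $y$ of $u$ and $a\in P$, $a\ge y$ means $a\ge b$ for every letter $b$ of $y$, and $a\not\ge z$ means $a\not\ge b$ for every letter $b$ of $z$.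
   Formalization: It is additionally assumed that the weights of all words form a summable family (each monomial occurs in finitely many of them); regularity alone does not make F and A well defined, e.g. P={a}, wt(a)=1+x, u=a. *)

theory Defs
  imports "HOL-Library.Poly_Mapping" "HOL-Library.Sublist"
begin

section \<open>Formal power series in several commuting variables\<close>

text \<open>
  A series over \<open>'a\<close> in variables indexed by \<open>'v\<close> is an arbitrary assignment of coefficients to
  monomials; the monomial $\prod_v x_v^{e(v)}$ is the exponent vector \<open>e :: 'v \<Rightarrow>\<^sub>0 nat\<close>.
  For \<open>'v :: finite\<close> this is the ring $A[[x_1,\ldots,x_m]]$ with \<open>m = CARD('v)\<close>.
\<close>

typedef (overloaded) ('v, 'a) mps = "UNIV :: (('v \<Rightarrow>\<^sub>0 nat) \<Rightarrow> 'a::zero) set"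
  morphisms mps_coeff Abs_mps
  by simp

lemma mps_eqI: "(\<And>e. mps_coeff f e = mps_coeff g e) \<Longrightarrow> f = g"
  by (simp add: mps_coeff_inject[symmetric] fun_eq_iff)

lemma mps_coeff_Abs [simp]: "mps_coeff (Abs_mps f) e = f e"
  by (simp add: Abs_mps_inverse)

definition antidiag :: "('v \<Rightarrow>\<^sub>0 nat) \<Rightarrow> (('v \<Rightarrow>\<^sub>0 nat) \<times> ('v \<Rightarrow>\<^sub>0 nat)) set" where
  "antidiag e = {(a, b). a + b = e}"

lemma mem_antidiag [simp]: "(a, b) \<in> antidiag e \<longleftrightarrow> a + b = e"
  by (simp add: antidiag_def)

lemma finite_antidiag [simp]:
  fixes e :: "'v \<Rightarrow>\<^sub>0 nat"
  shows "finite (antidiag e)"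
proof -
  let ?B = "\<Union>v\<in>Poly_Mapping.keys e. {..Poly_Mapping.lookup e v}"
  let ?S = "{f :: 'v \<Rightarrow> nat. \<forall>v. (v \<in> Poly_Mapping.keys e \<longrightarrow> f v \<in> ?B) \<and> (v \<notin> Poly_Mapping.keys e \<longrightarrow> f v = 0)}"
  have S: "Poly_Mapping.lookup a \<in> ?S"
    if le: "\<And>v. Poly_Mapping.lookup a v \<le> Poly_Mapping.lookup e v" for a :: "'v \<Rightarrow>\<^sub>0 nat"
  proof (intro CollectI allI conjI impI)
    fix v
    show "Poly_Mapping.lookup a v \<in> ?B" if "v \<in> Poly_Mapping.keys e"
      using that le[of v] by (intro UN_I) simp_all
    show "Poly_Mapping.lookup a v = 0" if "v \<notin> Poly_Mapping.keys e"
      using that le[of v] by (simp add: in_keys_iff)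
  qed
  have fin: "finite ?S"
    by (intro finite_set_of_finite_funs) auto
  have "inj (Poly_Mapping.lookup :: ('v \<Rightarrow>\<^sub>0 nat) \<Rightarrow> _)"
    by (simp add: inj_def)
  then have fin': "finite (Poly_Mapping.lookup -` ?S)"
    by (rule finite_vimageI[OF fin])
  have "antidiag e \<subseteq> (Poly_Mapping.lookup -` ?S) \<times> (Poly_Mapping.lookup -` ?S)"
  proof
    fix p assume "p \<in> antidiag e"
    then obtain a b where p: "p = (a, b)" and e: "e = a + b"
      by (cases p) auto
    have "Poly_Mapping.lookup a \<in> ?S" "Poly_Mapping.lookup b \<in> ?S"
      by (rule S, simp add: e lookup_add)+
    then show "p \<in> (Poly_Mapping.lookup -` ?S) \<times> (Poly_Mapping.lookup -` ?S)"
      unfolding p by (intro SigmaI vimageI2)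
  qed
  then show ?thesis
    by (rule finite_subset) (intro finite_cartesian_product fin')
qed

instantiation mps :: (type, comm_ring_1) comm_ring_1
begin

definition zero_mps :: "('a, 'b) mps" where "0 = Abs_mps (\<lambda>_. 0)"
definition one_mps :: "('a, 'b) mps" where "1 = Abs_mps (\<lambda>e. if e = 0 then 1 else 0)"
definition plus_mps :: "('a, 'b) mps \<Rightarrow> ('a, 'b) mps \<Rightarrow> ('a, 'b) mps" where
  "f + g = Abs_mps (\<lambda>e. mps_coeff f e + mps_coeff g e)"
definition minus_mps :: "('a, 'b) mps \<Rightarrow> ('a, 'b) mps \<Rightarrow> ('a, 'b) mps" where
  "f - g = Abs_mps (\<lambda>e. mps_coeff f e - mps_coeff g e)"
definition uminus_mps :: "('a, 'b) mps \<Rightarrow> ('a, 'b) mps" where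
  "- f = Abs_mps (\<lambda>e. - mps_coeff f e)"
definition times_mps :: "('a, 'b) mps \<Rightarrow> ('a, 'b) mps \<Rightarrow> ('a, 'b) mps" where
  "f * g = Abs_mps (\<lambda>e. \<Sum>(a, b)\<in>antidiag e. mps_coeff f a * mps_coeff g b)"

instance
proof
  fix f g h :: "('a, 'b) mps"
  show "f * g * h = f * (g * h)"
  proof (rule mps_eqI)
    fix e
    let ?F = "mps_coeff f" and ?G = "mps_coeff g" and ?H = "mps_coeff h"
    have "mps_coeff (f * g * h) e
        = (\<Sum>(d, c)\<in>antidiag e. \<Sum>(a, b)\<in>antidiag d. ?F a * ?G b * ?H c)"
      by (simp add: times_mps_def sum_distrib_right case_prod_beta)
    also have "\<dots> = (\<Sum>((d, c), (a, b))\<in>(SIGMA p:antidiag e. antidiag (fst p)). ?F a * ?G b * ?H c)"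
      by (subst sum.Sigma[symmetric]) (auto simp: case_prod_beta)
    also have "\<dots> = (\<Sum>((a, d), (b, c))\<in>(SIGMA p:antidiag e. antidiag (snd p)). ?F a * ?G b * ?H c)"
      by (rule sum.reindex_bij_witness[where
            i = "\<lambda>((a, d), (b, c)). ((a + b, c), (a, b))" and
            j = "\<lambda>((d, c), (a, b)). ((a, b + c), (b, c))"]) (auto simp: add.assoc)
    also have "\<dots> = (\<Sum>(a, d)\<in>antidiag e. \<Sum>(b, c)\<in>antidiag d. ?F a * ?G b * ?H c)"
      by (subst sum.Sigma[symmetric]) (auto simp: case_prod_beta)
    also have "\<dots> = mps_coeff (f * (g * h)) e"
      by (simp add: times_mps_def sum_distrib_left case_prod_beta mult.assoc)
    finally show "mps_coeff (f * g * h) e = mps_coeff (f * (g * h)) e" .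
  qed
  show "f * g = g * f"
    unfolding times_mps_def
    by (intro arg_cong[where f = Abs_mps] ext
        sum.reindex_bij_witness[where i = prod.swap and j = prod.swap])
      (auto simp: add.commute mult.commute)
  show "1 * f = f"
  proof (rule mps_eqI)
    fix e
    have "mps_coeff (1 * f) e
        = (\<Sum>p\<in>antidiag e. if p = (0, e) then mps_coeff f e else 0)"
      unfolding times_mps_def one_mps_def mps_coeff_Abs
      by (intro sum.cong) (auto split: if_splits)
    then show "mps_coeff (1 * f) e = mps_coeff f e"
      by simp
  qed
  show "(f + g) * h = f * h + g * h"
    by (simp add: times_mps_def plus_mps_def distrib_right sum.distrib case_prod_beta)
  have "mps_coeff (0 :: ('a, 'b) mps) 0 \<noteq> mps_coeff (1 :: ('a, 'b) mps) 0"
    by (simp add: zero_mps_def one_mps_def)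
  then show "(0 :: ('a, 'b) mps) \<noteq> 1"
    by (rule contrapos_nn) (rule arg_cong)
  show "f + g + h = f + (g + h)"
    by (rule mps_eqI) (simp add: plus_mps_def add.assoc)
  show "f + g = g + f"
    by (rule mps_eqI) (simp add: plus_mps_def add.commute)
  show "0 + f = f"
    by (rule mps_eqI) (simp add: plus_mps_def zero_mps_def)
  show "- f + f = 0"
    by (rule mps_eqI) (simp add: plus_mps_def zero_mps_def uminus_mps_def)
  show "f - g = f + - g"
    by (rule mps_eqI) (simp add: plus_mps_def minus_mps_def uminus_mps_def)
qed

end

definition mps_polynomial :: "('v, 'a::zero) mps \<Rightarrow> bool" where
  "mps_polynomial f \<longleftrightarrow> finite {e. mps_coeff f e \<noteq> 0}"

definition mps_rational :: "('v, 'a::comm_ring_1) mps \<Rightarrow> bool" where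
  "mps_rational f \<longleftrightarrow> (\<exists>p q. mps_polynomial p \<and> mps_polynomial q \<and> q \<noteq> 0 \<and> q * f = p)"

text \<open>
  A family of series has a well-defined formal sum if every monomial occurs in only finitely many
  of its members. Without this condition the value of \<open>mps_sum\<close> is meaningless.
\<close>

definition mps_summable :: "('i \<Rightarrow> ('v, 'a::comm_ring_1) mps) \<Rightarrow> 'i set \<Rightarrow> bool" where
  "mps_summable f I \<longleftrightarrow> (\<forall>e. finite {i \<in> I. mps_coeff (f i) e \<noteq> 0})"

definition mps_sum :: "('i \<Rightarrow> ('v, 'a::comm_ring_1) mps) \<Rightarrow> 'i set \<Rightarrow> ('v, 'a) mps" where
  "mps_sum f I = Abs_mps (\<lambda>e. \<Sum>i\<in>{i \<in> I. mps_coeff (f i) e \<noteq> 0}. mps_coeff (f i) e)"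


section \<open>Weights of words\<close>

definition word_weight :: "('p \<Rightarrow> ('v, 'a::comm_ring_1) mps) \<Rightarrow> 'p list \<Rightarrow> ('v, 'a) mps" where
  "word_weight wt w = prod_list (map wt w)"

definition regular_weight :: "('p \<Rightarrow> ('v, 'a::comm_ring_1) mps) \<Rightarrow> bool" where
  "regular_weight wt \<longleftrightarrow> (\<forall>f. finite {w. word_weight wt w = f})"

text \<open>
  For arbitrary series as weights, regularity alone does not make sums over languages well-defined:
  on the alphabet of positive integers, the weights $1 + x^n$ are regular, but the constant term of
  every word is 1. If all weights are monomials, regularity suffices:
\<close>

definition mps_monom :: "('v \<Rightarrow>\<^sub>0 nat) \<Rightarrow> ('v, 'a::comm_ring_1) mps" where
  "mps_monom d = Abs_mps (\<lambda>e. if e = d then 1 else 0)"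

lemma mps_monom_mult: "mps_monom c * mps_monom d = mps_monom (c + d)"
proof (rule mps_eqI)
  fix e
  have "mps_coeff (mps_monom c * mps_monom d :: ('a, 'b) mps) e
      = (\<Sum>p\<in>antidiag e. if p = (c, d) then 1 else 0)"
    unfolding times_mps_def mps_monom_def mps_coeff_Abs
    by (intro sum.cong) (auto split: if_splits)
  then show "mps_coeff (mps_monom c * mps_monom d :: ('a, 'b) mps) e
      = mps_coeff (mps_monom (c + d)) e"
    by (auto simp: mps_monom_def)
qed

lemma regular_monomial_weight_summable:
  fixes wt :: "'p \<Rightarrow> ('v, 'a::comm_ring_1) mps"
  assumes "\<And>a. wt a \<in> range mps_monom" and "regular_weight wt"
  shows "mps_summable (word_weight wt) UNIV"
proof -
  have ex: "\<exists>d. word_weight wt w = mps_monom d" for w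
  proof (induction w)
    case Nil
    have "word_weight wt [] = mps_monom 0"
      by (simp add: word_weight_def mps_monom_def one_mps_def)
    then show ?case ..
  next
    case (Cons a w)
    obtain c where "wt a = mps_monom c"
      using assms(1)[of a] by auto
    moreover obtain d where "word_weight wt w = mps_monom d"
      using Cons by blast
    ultimately have "word_weight wt (a # w) = mps_monom (c + d)"
      by (simp add: word_weight_def mps_monom_mult)
    then show ?case ..
  qed
  have *: "word_weight wt w = mps_monom e" if "mps_coeff (word_weight wt w) e \<noteq> 0" for w e
  proof -
    obtain d where d: "word_weight wt w = mps_monom d"
      using ex by blast
    with that have "e = d"
      by (simp add: mps_monom_def split: if_splits)
    with d show ?thesis by simp
  qed
  have "{w \<in> UNIV. mps_coeff (word_weight wt w) e \<noteq> 0} \<subseteq> {w. word_weight wt w = mps_monom e}" for e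
    using *[of _ e] by blast
  moreover have "finite {w. word_weight wt w = mps_monom e}" for e
    using assms(2) by (simp add: regular_weight_def)
  ultimately show ?thesis
    unfolding mps_summable_def by (meson finite_subset)
qed


section \<open>Generalized factor order\<close>

definition embedding :: "'p::order list \<Rightarrow> 'p list \<Rightarrow> bool" where
  "embedding u w' \<longleftrightarrow> list_all2 (\<le>) u w'"

definition gfactor_le :: "'p::order list \<Rightarrow> 'p list \<Rightarrow> bool" where
  "gfactor_le u w \<longleftrightarrow> (\<exists>w'. sublist w' w \<and> embedding u w')"

definition factor_lang :: "'p::order list \<Rightarrow> 'p list set" where
  "factor_lang u = {w. gfactor_le u w}"

text \<open>
  An embedding is an occurrence of a factor at a given position: every occurrence \<open>w = v @ w' @ v'\<close>
  has to end at the right end of \<open>w\<close>. It is not enough that \<open>w'\<close> is equal, as a word, to a suffix.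
\<close>

definition suffix_lang :: "'p::order list \<Rightarrow> 'p list set" where
  "suffix_lang u = {w \<in> factor_lang u. \<forall>v w' v'. w = v @ w' @ v' \<and> embedding u w' \<longrightarrow> v' = []}"

definition avoid_lang :: "'p::order list \<Rightarrow> 'p list set" where
  "avoid_lang u = {w. \<not> gfactor_le u w}"

definition factor_gf :: "('p::order \<Rightarrow> ('v, 'a::comm_ring_1) mps) \<Rightarrow> 'p list \<Rightarrow> ('v, 'a) mps" where
  "factor_gf wt u = mps_sum (word_weight wt) (factor_lang u)"

definition suffix_gf :: "('p::order \<Rightarrow> ('v, 'a::comm_ring_1) mps) \<Rightarrow> 'p list \<Rightarrow> ('v, 'a) mps" where
  "suffix_gf wt u = mps_sum (word_weight wt) (suffix_lang u)"

definition avoid_gf :: "('p::order \<Rightarrow> ('v, 'a::comm_ring_1) mps) \<Rightarrow> 'p list \<Rightarrow> ('v, 'a) mps" where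
  "avoid_gf wt u = mps_sum (word_weight wt) (avoid_lang u)"

end

theory Submission
  imports Defs
begin

text \<open>
  Sort the letters by the set of positions \<open>j\<close> with \<open>u ! j \<le> a\<close>. A finite automaton that reads these
  types recognises all three languages, so their generating functions are sums of solutions of a
  linear system whose coefficients are sums of the given rational series. Summability of the words
  $a, aa, aaa, \ldots$ forces every letter to have constant term 0, hence all pivots in Gaussian
  elimination have constant term 1 and are units.
\<close>

section \<open>Coefficients and formal sums\<close>

lemma mps_coeff_simps [simp]:
  "mps_coeff 0 e = 0"
  "mps_coeff (f + g) e = mps_coeff f e + mps_coeff g e"
  "mps_coeff (f - g) e = mps_coeff f e - mps_coeff g e"
  by (simp_all add: zero_mps_def plus_mps_def minus_mps_def)

lemma mps_coeff_1: "mps_coeff 1 e = (if e = 0 then 1 else 0)"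
  by (simp add: one_mps_def)

lemma mps_coeff_mult:
  "mps_coeff (f * g) e = (\<Sum>(a, b)\<in>antidiag e. mps_coeff f a * mps_coeff g b)"
  by (simp add: times_mps_def)

lemma mps_coeff_mult_nonzeroE:
  assumes "mps_coeff (f * g) e \<noteq> 0"
  obtains a b where "(a, b) \<in> antidiag e" "mps_coeff f a \<noteq> 0" "mps_coeff g b \<noteq> 0"
proof -
  obtain p where p: "p \<in> antidiag e" "(case p of (a, b) \<Rightarrow> mps_coeff f a * mps_coeff g b) \<noteq> 0"
    using assms unfolding mps_coeff_mult by (rule sum.not_neutral_contains_not_neutral)
  then show ?thesis
    by (cases p) (auto intro!: that)
qed

lemma mps_coeff_sum: "mps_coeff (\<Sum>i\<in>I. f i) e = (\<Sum>i\<in>I. mps_coeff (f i) e)"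
  by (induction I rule: infinite_finite_induct) auto

lemma antidiag_0: "antidiag (0 :: 'v \<Rightarrow>\<^sub>0 nat) = {(0, 0)}"
proof -
  have "a = 0 \<and> b = 0" if "a + b = 0" for a b :: "'v \<Rightarrow>\<^sub>0 nat"
  proof -
    have "Poly_Mapping.lookup a v + Poly_Mapping.lookup b v = 0" for v
      using arg_cong[OF that, of "\<lambda>e. Poly_Mapping.lookup e v"] by (simp add: lookup_add)
    then show ?thesis
      by (auto intro!: poly_mapping_eqI)
  qed
  moreover have "(0 :: 'v \<Rightarrow>\<^sub>0 nat) + 0 = 0"
    by simp
  ultimately show ?thesis
    unfolding antidiag_def by blast
qed

lemma mps_coeff_mult_0: "mps_coeff (f * g) 0 = mps_coeff f 0 * mps_coeff g 0"
  by (simp add: mps_coeff_mult antidiag_0)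

lemma mps_coeff_power_0: "mps_coeff (f ^ k) 0 = mps_coeff f 0 ^ k"
  by (induction k) (simp_all add: mps_coeff_1 mps_coeff_mult_0)

section \<open>Rearrangement of formal sums\<close>

lemma mps_summable_subset:
  assumes "mps_summable f J" "I \<subseteq> J"
  shows "mps_summable f I"
  unfolding mps_summable_def
proof
  fix e
  have "finite {i \<in> J. mps_coeff (f i) e \<noteq> 0}"
    using assms(1) by (simp add: mps_summable_def)
  then show "finite {i \<in> I. mps_coeff (f i) e \<noteq> 0}"
    by (rule rev_finite_subset) (use assms(2) in auto)
qed

lemma mps_summable_reindex:
  assumes "mps_summable f UNIV" "inj_on h I"
  shows "mps_summable (f \<circ> h) I"
  unfolding mps_summable_def
proof
  fix e
  have "finite (h -` {i. mps_coeff (f i) e \<noteq> 0} \<inter> I)"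
    using assms unfolding mps_summable_def by (intro finite_vimage_IntI) auto
  then show "finite {i \<in> I. mps_coeff ((f \<circ> h) i) e \<noteq> 0}"
    by (rule rev_finite_subset) auto
qed

text \<open>\<open>S\<close> may be larger than the support of coefficient \<open>e\<close>, so that
  sums with different supports can be compared over one finite index set.\<close>

lemma mps_coeff_mps_sum:
  assumes "finite S" "S \<subseteq> I" "\<And>i. i \<in> I \<Longrightarrow> mps_coeff (f i) e \<noteq> 0 \<Longrightarrow> i \<in> S"
  shows "mps_coeff (mps_sum f I) e = (\<Sum>i\<in>S. mps_coeff (f i) e)"
  unfolding mps_sum_def mps_coeff_Abs
  using assms by (intro sum.mono_neutral_left) auto

lemma mps_sum_reindex:
  assumes "inj_on h I"
  shows "mps_sum f (h ` I) = mps_sum (f \<circ> h) I"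
proof (rule mps_eqI)
  fix e
  have "{i \<in> h ` I. mps_coeff (f i) e \<noteq> 0} = h ` {i \<in> I. mps_coeff ((f \<circ> h) i) e \<noteq> 0}"
    by auto
  moreover have "inj_on h {i \<in> I. mps_coeff ((f \<circ> h) i) e \<noteq> 0}"
    by (rule inj_on_subset[OF assms]) auto
  ultimately show "mps_coeff (mps_sum f (h ` I)) e = mps_coeff (mps_sum (f \<circ> h) I) e"
    by (simp add: mps_sum_def sum.reindex)
qed

text \<open>At each monomial only finitely many indices contribute, so the claim reduces to grouping
  a finite sum by the value of \<open>h\<close>. Below, \<open>h\<close> reads off the state before
  the last letter together with the type of that letter, or the final state.\<close>

lemma mps_sum_partition:
  assumes "mps_summable f I" "finite Q" "h ` I \<subseteq> Q"
  shows "mps_sum f I = (\<Sum>q\<in>Q. mps_sum f {i \<in> I. h i = q})"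
proof (rule mps_eqI)
  fix e
  define S where "S = {i \<in> I. mps_coeff (f i) e \<noteq> 0}"
  have S: "finite S" "S \<subseteq> I"
    using assms(1) by (auto simp: S_def mps_summable_def)
  have "mps_coeff (mps_sum f I) e = (\<Sum>i\<in>S. mps_coeff (f i) e)"
    using S by (intro mps_coeff_mps_sum) (auto simp: S_def)
  also have "\<dots> = (\<Sum>q\<in>Q. \<Sum>i\<in>{i \<in> S. h i = q}. mps_coeff (f i) e)"
    using S assms by (subst sum.group) auto
  also have "\<dots> = (\<Sum>q\<in>Q. mps_coeff (mps_sum f {i \<in> I. h i = q}) e)"
    using S(2) by (intro sum.cong refl mps_coeff_mps_sum[symmetric])
      (auto simp: S_def intro: rev_finite_subset[OF S(1)[unfolded S_def]])
  finally show "mps_coeff (mps_sum f I) e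
      = mps_coeff (\<Sum>q\<in>Q. mps_sum f {i \<in> I. h i = q}) e"
    by (simp add: mps_coeff_sum)
qed

lemma mps_sum_Un_disjoint:
  assumes "mps_summable f (I \<union> J)" "I \<inter> J = {}"
  shows "mps_sum f (I \<union> J) = mps_sum f I + mps_sum f J"
proof -
  have "{i \<in> I \<union> J. i \<in> I} = I" "{i \<in> I \<union> J. i \<notin> I} = J"
    using assms(2) by auto
  then show ?thesis
    using mps_sum_partition[OF assms(1) finite subset_UNIV, of "\<lambda>i. i \<in> I"]
    by (simp add: UNIV_bool add.commute)
qed

lemma mps_sum_singleton: "mps_sum f {i} = f i"
  by (rule mps_eqI, subst mps_coeff_mps_sum[where S = "{i}"]) auto

lemma mps_sum_empty: "mps_sum f {} = 0"
  by (rule mps_eqI, subst mps_coeff_mps_sum[where S = "{}"]) auto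

text \<open>Concatenating two languages multiplies their series. A monomial has finitely many
  splittings, and each splitting meets finitely many members of either family, so the distributive
  law is applied to finite sums only.\<close>

lemma mps_sum_times:
  assumes f: "mps_summable f I" and g: "mps_summable g J"
  shows "mps_sum (\<lambda>(i, j). f i * g j) (I \<times> J) = mps_sum f I * mps_sum g J"
proof (rule mps_eqI)
  fix e
  \<comment> \<open>\<open>A\<close> and \<open>B\<close> collect the indices relevant to some
    splitting of \<open>e\<close>; being independent of the splitting, they allow the order of
    summation to be exchanged.\<close>
  define A where "A = (\<Union>p\<in>antidiag e. {i \<in> I. mps_coeff (f i) (fst p) \<noteq> 0})"
  define B where "B = (\<Union>p\<in>antidiag e. {j \<in> J. mps_coeff (g j) (snd p) \<noteq> 0})"
  have A: "finite A" "A \<subseteq> I" and B: "finite B" "B \<subseteq> J"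
    using f g by (auto simp: A_def B_def mps_summable_def)
  have "mps_coeff (mps_sum f I * mps_sum g J) e
      = (\<Sum>(a, b)\<in>antidiag e. (\<Sum>i\<in>A. mps_coeff (f i) a) * (\<Sum>j\<in>B. mps_coeff (g j) b))"
    unfolding mps_coeff_mult
  proof (intro sum.cong refl, clarify)
    fix a b assume "(a, b) \<in> antidiag e"
    then have iA: "i \<in> A" if "i \<in> I" "mps_coeff (f i) a \<noteq> 0" for i
      using that unfolding A_def by (intro UN_I[of "(a, b)"]) auto
    have jB: "j \<in> B" if "j \<in> J" "mps_coeff (g j) b \<noteq> 0" for j
      using that \<open>(a, b) \<in> antidiag e\<close> unfolding B_def by (intro UN_I[of "(a, b)"]) auto
    have "mps_coeff (mps_sum f I) a = (\<Sum>i\<in>A. mps_coeff (f i) a)"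
      by (rule mps_coeff_mps_sum[OF A iA])
    moreover have "mps_coeff (mps_sum g J) b = (\<Sum>j\<in>B. mps_coeff (g j) b)"
      by (rule mps_coeff_mps_sum[OF B jB])
    ultimately show "mps_coeff (mps_sum f I) a * mps_coeff (mps_sum g J) b
        = (\<Sum>i\<in>A. mps_coeff (f i) a) * (\<Sum>j\<in>B. mps_coeff (g j) b)"
      by simp
  qed
  also have "\<dots> = (\<Sum>p\<in>antidiag e. \<Sum>(i, j)\<in>A \<times> B. mps_coeff (f i) (fst p) * mps_coeff (g j) (snd p))"
    by (simp add: sum_product sum.cartesian_product case_prod_beta)
  also have "\<dots> = (\<Sum>(i, j)\<in>A \<times> B. mps_coeff (f i * g j) e)"
    unfolding mps_coeff_mult by (subst sum.swap) (simp add: case_prod_beta)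
  also have "\<dots> = (\<Sum>p\<in>A \<times> B. mps_coeff (case p of (i, j) \<Rightarrow> f i * g j) e)"
    by (simp add: case_prod_beta)
  also have "\<dots> = mps_coeff (mps_sum (\<lambda>(i, j). f i * g j) (I \<times> J)) e"
  proof (rule mps_coeff_mps_sum[symmetric])
    fix p assume p: "p \<in> I \<times> J" and nz: "mps_coeff (case p of (i, j) \<Rightarrow> f i * g j) e \<noteq> 0"
    obtain i j where ij: "p = (i, j)" "i \<in> I" "j \<in> J"
      using p by auto
    with nz have "mps_coeff (f i * g j) e \<noteq> 0"
      by simp
    then obtain a b where "(a, b) \<in> antidiag e" "mps_coeff (f i) a \<noteq> 0" "mps_coeff (g j) b \<noteq> 0"
      by (rule mps_coeff_mult_nonzeroE)
    with ij show "p \<in> A \<times> B"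
      unfolding A_def B_def by (auto intro!: bexI[of _ "(a, b)"])
  qed (use A B in auto)
  finally show "mps_coeff (mps_sum (\<lambda>(i, j). f i * g j) (I \<times> J)) e
      = mps_coeff (mps_sum f I * mps_sum g J) e" ..
qed


section \<open>Rational series\<close>

lemma mps_polynomial_0 [simp]: "mps_polynomial 0"
  by (simp add: mps_polynomial_def)

lemma mps_polynomial_1 [simp]: "mps_polynomial 1"
  unfolding mps_polynomial_def by (rule finite_subset[of _ "{0}"]) (auto simp: mps_coeff_1)

lemma mps_polynomial_add:
  assumes "mps_polynomial p" "mps_polynomial q"
  shows "mps_polynomial (p + q)"
  using finite_UnI[OF assms[unfolded mps_polynomial_def]]
  unfolding mps_polynomial_def by (rule rev_finite_subset) auto

lemma mps_polynomial_diff: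
  assumes "mps_polynomial p" "mps_polynomial q"
  shows "mps_polynomial (p - q)"
  using finite_UnI[OF assms[unfolded mps_polynomial_def]]
  unfolding mps_polynomial_def by (rule rev_finite_subset) auto

lemma mps_polynomial_mult:
  assumes "mps_polynomial p" "mps_polynomial q"
  shows "mps_polynomial (p * q)"
proof -
  let ?S = "\<lambda>p. {e. mps_coeff p e \<noteq> 0}"
  have "e \<in> (\<lambda>(a, b). a + b) ` (?S p \<times> ?S q)" if nz: "mps_coeff (p * q) e \<noteq> 0" for e
  proof -
    obtain a b where "(a, b) \<in> antidiag e" "mps_coeff p a \<noteq> 0" "mps_coeff q b \<noteq> 0"
      using nz by (rule mps_coeff_mult_nonzeroE)
    then show ?thesis
      by (intro image_eqI[of _ _ "(a, b)"]) auto
  qed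
  then have "?S (p * q) \<subseteq> (\<lambda>(a, b). a + b) ` (?S p \<times> ?S q)"
    by blast
  then show ?thesis
    using assms unfolding mps_polynomial_def
    by (meson finite_SigmaI finite_imageI finite_subset)
qed

text \<open>
  \<open>'v\<close> carries no linear order, so monomials are compared after renaming the variables to natural
  numbers; the product of the two smallest monomials is then obtained only once in the product.
\<close>

lemma mps_polynomial_no_zero_divisors:
  fixes p q :: "('v::finite, 'a::idom) mps"
  assumes "mps_polynomial p" "p \<noteq> 0" "mps_polynomial q" "q \<noteq> 0"
  shows "p * q \<noteq> 0"
proof -
  obtain idx :: "'v \<Rightarrow> nat" where idx: "inj idx"
    using finite_imp_inj_to_nat_seg[of "UNIV :: 'v set"] by auto
  define \<psi> :: "('v \<Rightarrow>\<^sub>0 nat) \<Rightarrow> (nat \<Rightarrow>\<^sub>0 nat)"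
    where "\<psi> e = (\<Sum>v\<in>UNIV. Poly_Mapping.single (idx v) (Poly_Mapping.lookup e v))" for e
  have add: "\<psi> (a + b) = \<psi> a + \<psi> b" for a b
    by (simp add: \<psi>_def lookup_add single_add sum.distrib)
  have lookup: "Poly_Mapping.lookup (\<psi> e) (idx v) = Poly_Mapping.lookup e v" for e v
  proof -
    have "Poly_Mapping.lookup (\<psi> e) (idx v)
        = (\<Sum>w\<in>UNIV. if w = v then Poly_Mapping.lookup e v else 0)"
      unfolding \<psi>_def lookup_sum
      by (intro sum.cong refl) (use idx in \<open>auto simp: lookup_single when_def inj_eq\<close>)
    then show ?thesis by simp
  qed
  have inj: "a = b" if "\<psi> a = \<psi> b" for a b
    by (rule poly_mapping_eqI) (metis lookup that)
  have least: "\<exists>a. mps_coeff f a \<noteq> 0 \<and> (\<forall>b. mps_coeff f b \<noteq> 0 \<longrightarrow> \<psi> a \<le> \<psi> b)"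
    if "mps_polynomial f" "f \<noteq> 0" for f :: "('v, 'a) mps"
  proof -
    let ?S = "{e. mps_coeff f e \<noteq> 0}"
    have "?S \<noteq> {}"
      using that(2) mps_eqI[of f 0] by auto
    then have "Min (\<psi> ` ?S) \<in> \<psi> ` ?S" "\<forall>b\<in>?S. Min (\<psi> ` ?S) \<le> \<psi> b"
      using that(1) by (auto simp: mps_polynomial_def)
    then show ?thesis by auto
  qed
  obtain a where a: "mps_coeff p a \<noteq> 0" "\<And>c. mps_coeff p c \<noteq> 0 \<Longrightarrow> \<psi> a \<le> \<psi> c"
    using least[OF assms(1,2)] by auto
  obtain b where b: "mps_coeff q b \<noteq> 0" "\<And>c. mps_coeff q c \<noteq> 0 \<Longrightarrow> \<psi> b \<le> \<psi> c"
    using least[OF assms(3,4)] by auto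
  have unique: "c = a \<and> d = b"
    if cd: "c + d = a + b" and nz: "mps_coeff p c \<noteq> 0" "mps_coeff q d \<noteq> 0" for c d
  proof -
    have eq: "\<psi> c + \<psi> d = \<psi> a + \<psi> b"
      using cd by (metis add)
    moreover have "\<psi> a \<le> \<psi> c" "\<psi> b \<le> \<psi> d"
      using a b nz by auto
    \<comment> \<open>Addition is strictly monotone for this linear order, so a strict inequality in
      one summand would make the left sum strictly larger.\<close>
    ultimately have "\<psi> c = \<psi> a"
      by (metis add_less_le_mono order_less_le)
    then have "c = a" by (rule inj)
    with cd show ?thesis by simp
  qed
  have "mps_coeff (p * q) (a + b) = (\<Sum>(c, d)\<in>{(a, b)}. mps_coeff p c * mps_coeff q d)"
    unfolding mps_coeff_mult using unique by (intro sum.mono_neutral_right) auto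
  with a b show ?thesis
    by auto
qed

lemma mps_rationalI:
  "mps_polynomial p \<Longrightarrow> mps_polynomial q \<Longrightarrow> q \<noteq> 0 \<Longrightarrow> q * f = p \<Longrightarrow> mps_rational f"
  unfolding mps_rational_def by blast

lemma mps_rational_polynomial: "mps_polynomial f \<Longrightarrow> mps_rational f"
  unfolding mps_rational_def by (intro exI[of _ f] exI[of _ 1]) simp

lemma mps_rational_0 [simp]: "mps_rational 0"
  and mps_rational_1 [simp]: "mps_rational 1"
  by (simp_all add: mps_rational_polynomial)

text \<open>The product of the two denominators serves all three operations. It is nonzero because
  nonzero polynomials over a domain have a nonzero product.\<close>

lemma mps_rational_closed:
  fixes f g :: "('v::finite, 'a::idom) mps"
  assumes "mps_rational f" "mps_rational g"
  shows mps_rational_add: "mps_rational (f + g)"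
    and mps_rational_diff: "mps_rational (f - g)"
    and mps_rational_mult: "mps_rational (f * g)"
proof -
  obtain p q where f: "mps_polynomial p" "mps_polynomial q" "q \<noteq> 0" "q * f = p"
    using assms unfolding mps_rational_def by blast
  obtain r s where g: "mps_polynomial r" "mps_polynomial s" "s \<noteq> 0" "s * g = r"
    using assms unfolding mps_rational_def by blast
  have qs: "mps_polynomial (q * s)" "q * s \<noteq> 0"
    using f g by (simp_all add: mps_polynomial_mult mps_polynomial_no_zero_divisors)
  have eq: "q * s * (f + g) = p * s + q * r" "q * s * (f - g) = p * s - q * r"
    "q * s * (f * g) = p * r"
    unfolding f(4)[symmetric] g(4)[symmetric] by (simp_all add: algebra_simps)
  note polynomial = mps_polynomial_mult mps_polynomial_add mps_polynomial_diff f(1,2) g(1,2)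
  show "mps_rational (f + g)"
    by (rule mps_rationalI[OF _ qs eq(1)]) (intro polynomial)
  show "mps_rational (f - g)"
    by (rule mps_rationalI[OF _ qs eq(2)]) (intro polynomial)
  show "mps_rational (f * g)"
    by (rule mps_rationalI[OF _ qs eq(3)]) (intro polynomial)
qed

lemma mps_rational_sum:
  fixes f :: "'i \<Rightarrow> ('v::finite, 'a::idom) mps"
  assumes "\<And>i. i \<in> I \<Longrightarrow> mps_rational (f i)"
  shows "mps_rational (\<Sum>i\<in>I. f i)"
  using assms by (induction I rule: infinite_finite_induct) (auto intro: mps_rational_add)

text \<open>Inversion swaps numerator and denominator: \<open>q * f = p\<close> becomes
  \<open>p * g = q\<close>, and \<open>p = 0\<close> would force \<open>q = 0\<close>.\<close>

lemma mps_rational_inverse: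
  assumes "mps_rational f" "f * g = 1"
  shows "mps_rational g"
proof -
  obtain p q where f: "mps_polynomial p" "mps_polynomial q" "q \<noteq> 0" "q * f = p"
    using assms(1) unfolding mps_rational_def by blast
  have "p * g = q"
    using assms(2) by (simp add: f(4)[symmetric] mult.assoc)
  moreover from this have "p \<noteq> 0"
    using f by auto
  ultimately show ?thesis
    using f by (intro mps_rationalI)
qed

section \<open>Units and linear systems with rational coefficients\<close>

text \<open>The inverse is the geometric series: \<open>f ^ k\<close> has no monomial of total
  degree below \<open>k\<close>, so each coefficient of the partial sums stabilises.\<close>

lemma mps_one_minus_unit:
  fixes f :: "('v::finite, 'a::comm_ring_1) mps"
  assumes "mps_coeff f 0 = 0"
  shows "\<exists>g. (1 - f) * g = 1"
proof -
  define deg :: "('v \<Rightarrow>\<^sub>0 nat) \<Rightarrow> nat" where "deg e = (\<Sum>v\<in>UNIV. Poly_Mapping.lookup e v)" for e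
  have deg_add: "deg (a + b) = deg a + deg b" for a b
    by (simp add: deg_def lookup_add sum.distrib)
  have deg_0: "e = 0" if "deg e = 0" for e
    using that by (intro poly_mapping_eqI) (simp add: deg_def)
  have power: "mps_coeff (f ^ k) e = 0" if "deg e < k" for k e
    using that
  proof (induction k arbitrary: e)
    case (Suc k)
    have "mps_coeff f a * mps_coeff (f ^ k) b = 0" if "a + b = e" for a b
    proof (cases "a = 0")
      case False
      then have "deg a \<noteq> 0" using deg_0 by blast
      then show ?thesis
        using Suc deg_add[of a b] that by simp
    qed (simp add: assms)
    then show ?case
      by (simp add: mps_coeff_mult) (intro sum.neutral, auto)
  qed simp
  define G where "G n = (\<Sum>k\<le>n. f ^ k)" for n
  \<comment> \<open>The coefficient at \<open>e\<close> is taken from the partial sum with last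
    exponent \<open>deg e\<close>, after which it no longer changes.\<close>
  define g where "g = Abs_mps (\<lambda>e. mps_coeff (G (deg e)) e)"
  have g: "mps_coeff g e = mps_coeff (G n) e" if "deg e \<le> n" for e n
    unfolding g_def mps_coeff_Abs G_def mps_coeff_sum
    using that power by (intro sum.mono_neutral_left) auto
  have "(1 - f) * g = 1"
  proof (rule mps_eqI)
    fix e
    \<comment> \<open>In a splitting \<open>a + b = e\<close> the degree of \<open>b\<close> is at
      most \<open>deg e\<close>, so the single partial sum \<open>G (deg e)\<close> can replace
      \<open>g\<close> in the whole convolution.\<close>
    have "mps_coeff ((1 - f) * g) e = mps_coeff ((1 - f) * G (deg e)) e"
      unfolding mps_coeff_mult by (intro sum.cong refl) (auto simp: g[of _ "deg e"] deg_add)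
    also have "(1 - f) * G (deg e) = 1 - f ^ Suc (deg e)"
      unfolding G_def by (rule sum_gp_basic)
    also have "mps_coeff \<dots> e = mps_coeff 1 e"
      using power[of e "Suc (deg e)"] by simp
    finally show "mps_coeff ((1 - f) * g) e = mps_coeff 1 e" .
  qed
  then show ?thesis ..
qed

text \<open>Gaussian elimination, one unknown per induction step. The solution \<open>X\<close> is
  given and only its rationality is at stake; \<open>b\<close> and \<open>M\<close> vary because
  elimination changes them. The entries keep constant term 0, so the next pivot is again a
  unit.\<close>

lemma mps_rational_linear_system:
  fixes X :: "'q \<Rightarrow> ('v::finite, 'a::idom) mps"
  assumes "finite Q"
    and "\<And>q. q \<in> Q \<Longrightarrow> mps_rational (b q)"
    and "\<And>q r. q \<in> Q \<Longrightarrow> r \<in> Q \<Longrightarrow> mps_rational (M q r)"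
    and "\<And>q r. q \<in> Q \<Longrightarrow> r \<in> Q \<Longrightarrow> mps_coeff (M q r) 0 = 0"
    and "\<And>q. q \<in> Q \<Longrightarrow> X q = b q + (\<Sum>r\<in>Q. M q r * X r)"
  shows "\<forall>q\<in>Q. mps_rational (X q)"
  using assms
proof (induction Q arbitrary: b M rule: finite_induct)
  case (insert p Q)
  note rat = insert.prems(1,2) and const = insert.prems(3)
  obtain g where g: "(1 - M p p) * g = 1"
    using mps_one_minus_unit const by blast
  have rat_g: "mps_rational g"
    by (rule mps_rational_inverse[OF mps_rational_diff g]) (simp_all add: rat)
  have eq: "X q = b q + M q p * X p + (\<Sum>r\<in>Q. M q r * X r)" if "q \<in> insert p Q" for q
    using insert.prems(4)[OF that] insert.hyps by (simp add: algebra_simps)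
  \<comment> \<open>Row \<open>p\<close> is solved for \<open>X p\<close> by multiplying with the
    inverse \<open>g\<close> of the pivot.\<close>
  have "X p = (1 - M p p) * g * X p"
    by (simp add: g)
  also have "\<dots> = g * (X p - M p p * X p)"
    by (simp add: algebra_simps)
  also have "X p - M p p * X p = b p + (\<Sum>r\<in>Q. M p r * X r)"
    using eq[of p] by (simp add: algebra_simps)
  finally have Xp: "X p = g * (b p + (\<Sum>r\<in>Q. M p r * X r))" .
  \<comment> \<open>The new data come from substituting the formula for \<open>X p\<close> into the
    remaining rows; the new matrix is the Schur complement of the pivot.\<close>
  have IH: "\<forall>q\<in>Q. mps_rational (X q)"
  proof (rule insert.IH[where b = "\<lambda>q. b q + M q p * g * b p"
        and M = "\<lambda>q r. M q r + M q p * g * M p r"])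
    fix q assume q: "q \<in> Q"
    have "X q = b q + M q p * (g * (b p + (\<Sum>r\<in>Q. M p r * X r))) + (\<Sum>r\<in>Q. M q r * X r)"
      using eq[of q] q Xp by simp
    also have "\<dots> = b q + M q p * g * b p + (\<Sum>r\<in>Q. (M q r + M q p * g * M p r) * X r)"
      by (simp add: algebra_simps sum.distrib sum_distrib_left)
    finally show "X q = \<dots>" .
  qed (auto simp: rat rat_g const mps_coeff_mult_0 intro!: mps_rational_add mps_rational_mult)
  have "mps_rational (X p)"
    unfolding Xp by (auto simp: rat rat_g IH intro!: mps_rational_add mps_rational_mult mps_rational_sum)
  with IH show ?case by simp
qed simp


section \<open>Languages recognised by finite automata\<close>

lemma word_weight_simps [simp]:
  "word_weight wt [] = 1"
  "word_weight wt (w @ [a]) = word_weight wt w * wt a"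
  by (simp_all add: word_weight_def)

lemma summable_letters:
  assumes "mps_summable (word_weight wt) UNIV"
  shows "mps_summable wt UNIV"
proof -
  have "wt = word_weight wt \<circ> (\<lambda>a. [a])"
    by (simp add: fun_eq_iff word_weight_def)
  then show ?thesis
    using mps_summable_reindex[OF assms, of "\<lambda>a. [a]" UNIV] by (simp add: inj_def)
qed

text \<open>Taking constant terms is multiplicative and \<open>'a\<close> is a domain, so a nonzero
  constant term would persist in all powers of the letter and the monomial 1 would occur in
  infinitely many words.\<close>

lemma letter_constant_coeff:
  fixes wt :: "'p \<Rightarrow> ('v, 'a::idom) mps"
  assumes "mps_summable (word_weight wt) UNIV"
  shows "mps_coeff (wt a) 0 = 0"
proof (rule ccontr)
  assume nz: "mps_coeff (wt a) 0 \<noteq> 0"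
  have "word_weight wt (replicate k a) = wt a ^ k" for k
    by (simp add: word_weight_def)
  then have "range (\<lambda>k. replicate k a) \<subseteq> {w \<in> UNIV. mps_coeff (word_weight wt w) 0 \<noteq> 0}"
    using nz by (auto simp: mps_coeff_power_0)
  then have "finite (range (\<lambda>k. replicate k a))"
    using assms unfolding mps_summable_def by (meson finite_subset)
  moreover have "inj (\<lambda>k. replicate k a)"
    by (rule inj_on_inverseI[of _ length]) simp
  ultimately show False
    using finite_imageD infinite_UNIV_nat by blast
qed

text \<open>The automaton is given by the state \<open>st w\<close> reached after each word, with
  initial state \<open>st []\<close>; \<open>R\<close> selects the accepting states. Letters of
  equal type act alike, so only the total weight of each type enters. There may be infinitely many
  letters, but the states and types are finite in number.\<close>

lemma mps_rational_automaton:
  fixes wt :: "'p \<Rightarrow> ('v::finite, 'a::idom) mps"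
    and ty :: "'p \<Rightarrow> 't" and st :: "'p list \<Rightarrow> 'q"
  assumes summable: "mps_summable (word_weight wt) UNIV"
    and fin: "finite Q" "finite T"
    and st: "\<And>w. st w \<in> Q" and ty: "\<And>a. ty a \<in> T"
    and step: "\<And>w a. st (w @ [a]) = \<delta> (st w) (ty a)"
    and rational: "\<And>t. t \<in> T \<Longrightarrow> mps_rational (mps_sum wt {a. ty a = t})"
  shows "mps_rational (mps_sum (word_weight wt) {w. R (st w)})"
proof -
  let ?W = "word_weight wt"
  define C where "C t = mps_sum wt {a. ty a = t}" for t
  define X where "X q = mps_sum ?W {w. st w = q}" for q
  have sub: "mps_summable ?W I" for I
    using mps_summable_subset[OF summable] by simp
  have sub': "mps_summable wt I" for I
    using mps_summable_subset[OF summable_letters[OF summable]] by simp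
  have C0: "mps_coeff (C t) 0 = 0" for t
    unfolding C_def mps_sum_def using letter_constant_coeff[OF summable] by simp
  define snoc :: "'p list \<times> 'p \<Rightarrow> 'p list" where "snoc = (\<lambda>(w, a). w @ [a])"
  have inj: "inj_on snoc I" for I
    by (auto simp: snoc_def inj_on_def)
  \<comment> \<open>Words reaching \<open>r\<close>, followed by a letter of type \<open>t\<close>,
    form a full product set, so their series factors.\<close>
  have block: "mps_sum (?W \<circ> snoc) {p. st (fst p) = r \<and> ty (snd p) = t} = X r * C t" for r t
  proof -
    have "{p. st (fst p) = r \<and> ty (snd p) = t} = {w. st w = r} \<times> {a. ty a = t}"
      by auto
    moreover have "?W \<circ> snoc = (\<lambda>(w, a). ?W w * wt a)"
      by (auto simp: snoc_def)
    ultimately show ?thesis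
      by (simp add: mps_sum_times sub sub' X_def C_def)
  qed
  \<comment> \<open>Splitting off the last letter gives the linear system: the entry for
    \<open>q\<close> and \<open>r\<close> is the weight of all letters leading from \<open>r\<close>
    to \<open>q\<close>, and the inhomogeneous term is the empty word.\<close>
  have X: "X q = (if st [] = q then 1 else 0)
      + (\<Sum>r\<in>Q. (\<Sum>t\<in>T. if \<delta> r t = q then C t else 0) * X r)" for q
  proof -
    let ?P = "{p. \<delta> (st (fst p)) (ty (snd p)) = q}"
    let ?h = "\<lambda>p. (st (fst p), ty (snd p))"
    have split: "{w. st w = q} = {w. w = [] \<and> st [] = q} \<union> snoc ` ?P"
    proof (intro set_eqI)
      fix w show "w \<in> {w. st w = q} \<longleftrightarrow> w \<in> {w. w = [] \<and> st [] = q} \<union> snoc ` ?P"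
        by (cases w rule: rev_cases) (force simp: snoc_def step)+
    qed
    have "X q = mps_sum ?W {w. w = [] \<and> st [] = q} + mps_sum ?W (snoc ` ?P)"
      unfolding X_def split by (rule mps_sum_Un_disjoint[OF sub]) (auto simp: snoc_def)
    also have "mps_sum ?W {w. w = [] \<and> st [] = q} = (if st [] = q then 1 else 0)"
      by (simp add: mps_sum_singleton mps_sum_empty)
    also have "mps_sum ?W (snoc ` ?P) = mps_sum (?W \<circ> snoc) ?P"
      by (rule mps_sum_reindex[OF inj])
    also have "\<dots> = (\<Sum>c\<in>Q \<times> T. mps_sum (?W \<circ> snoc) {p \<in> ?P. ?h p = c})"
      by (rule mps_sum_partition[OF mps_summable_reindex[OF summable inj]])
        (use fin st ty in auto)
    also have "\<dots> = (\<Sum>(r, t)\<in>Q \<times> T. (if \<delta> r t = q then C t else 0) * X r)"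
    proof (intro sum.cong refl, clarify)
      fix r t
      show "mps_sum (?W \<circ> snoc) {p \<in> ?P. ?h p = (r, t)} = (if \<delta> r t = q then C t else 0) * X r"
      proof (cases "\<delta> r t = q")
        case True
        then have "{p \<in> ?P. ?h p = (r, t)} = {p. st (fst p) = r \<and> ty (snd p) = t}"
          by auto
        with True show ?thesis
          by (simp only: block) (simp add: mult.commute)
      next
        case False
        then have "{p \<in> ?P. ?h p = (r, t)} = {}"
          by auto
        with False show ?thesis
          by (simp only: mps_sum_empty) simp
      qed
    qed
    finally show ?thesis
      by (simp add: sum.cartesian_product sum_distrib_right)
  qed
  have "\<forall>q\<in>Q. mps_rational (X q)"
    by (rule mps_rational_linear_system[OF fin(1) _ _ _ X])
      (auto simp: mps_coeff_sum C0 C_def[symmetric] rational[folded C_def]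
        intro!: mps_rational_sum sum.neutral)
  moreover have "mps_sum ?W {w. R (st w)} = (\<Sum>q\<in>Q. if R q then X q else 0)"
  proof -
    have "mps_sum ?W {w. R (st w)} = (\<Sum>q\<in>Q. mps_sum ?W {w \<in> {w. R (st w)}. st w = q})"
      by (rule mps_sum_partition[OF sub fin(1)]) (use st in auto)
    also have "\<dots> = (\<Sum>q\<in>Q. if R q then X q else 0)"
    proof (intro sum.cong refl)
      fix q
      have "{w \<in> {w. R (st w)}. st w = q} = (if R q then {w. st w = q} else {})"
        by auto
      then show "mps_sum ?W {w \<in> {w. R (st w)}. st w = q} = (if R q then X q else 0)"
        by (simp add: X_def mps_sum_empty)
    qed
    finally show ?thesis .
  qed
  ultimately show ?thesis
    by (auto intro!: mps_rational_sum)
qed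


section \<open>An automaton for embeddings\<close>

text \<open>These are the lengths of all prefixes of \<open>u\<close> that embed at the right end of
  \<open>w\<close>, that is, the states of a nondeterministic matcher tracked by the subset
  construction.\<close>

definition matched :: "'p::order list \<Rightarrow> 'p list \<Rightarrow> nat set" where
  "matched u w = {j. j \<le> length u \<and> (\<exists>v w'. w = v @ w' \<and> embedding (take j u) w')}"

text \<open>A nonempty prefix embeds at the new right end iff it does so without its last letter
  before \<open>a\<close> and that letter, \<open>u ! j\<close> for length \<open>Suc j\<close>,
  lies below \<open>a\<close>. The length 0 is always present, as a match may start
  anywhere.\<close>

lemma matched_snoc:
  "matched u (w @ [a]) = insert 0 (Suc ` (matched u w \<inter> {j. j < length u \<and> u ! j \<le> a}))"
proof (intro set_eqI)
  fix k
  show "k \<in> matched u (w @ [a])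
    \<longleftrightarrow> k \<in> insert 0 (Suc ` (matched u w \<inter> {j. j < length u \<and> u ! j \<le> a}))"
  proof (cases k)
    case 0
    then show ?thesis by (simp add: matched_def embedding_def)
  next
    case (Suc j)
    have last: "(\<exists>v w'. w @ [a] = v @ w' \<and> embedding (take (Suc j) u) w')
        \<longleftrightarrow> (\<exists>v w'. w = v @ w' \<and> embedding (take j u) w') \<and> u ! j \<le> a" (is "?L \<longleftrightarrow> ?R")
      if j: "j < length u"
    proof
      assume ?L
      then obtain v w' where w: "w @ [a] = v @ w'" and e: "embedding (take j u @ [u ! j]) w'"
        using j by (auto simp: take_Suc_conv_app_nth)
      from e obtain w'' b where w': "w' = w'' @ [b]" "embedding (take j u) w''" "u ! j \<le> b"
        unfolding embedding_def by (auto simp: list_all2_append1 list_all2_Cons1)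
      with w show ?R by auto
    next
      assume ?R
      then obtain v w' where "w = v @ w'" "embedding (take j u) w'" "u ! j \<le> a"
        by blast
      then show ?L
        using j by (intro exI[of _ v] exI[of _ "w' @ [a]"])
          (auto simp: take_Suc_conv_app_nth embedding_def intro: list_all2_appendI)
    qed
    have "k \<in> matched u (w @ [a])
        \<longleftrightarrow> j < length u \<and> (\<exists>v w'. w @ [a] = v @ w' \<and> embedding (take (Suc j) u) w')"
      unfolding Suc matched_def by (simp only: mem_Collect_eq Suc_le_eq)
    also have "\<dots> \<longleftrightarrow> j < length u \<and> (\<exists>v w'. w = v @ w' \<and> embedding (take j u) w') \<and> u ! j \<le> a"
      by (simp only: last cong: conj_cong)
    also have "\<dots> \<longleftrightarrow> j \<in> matched u w \<inter> {j. j < length u \<and> u ! j \<le> a}"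
      unfolding matched_def by (cases "j < length u") simp_all
    finally show ?thesis
      unfolding Suc by blast
  qed
qed

section \<open>Recursions for the languages along the last letter\<close>

lemma length_in_matched: "length u \<in> matched u w \<longleftrightarrow> (\<exists>v w'. w = v @ w' \<and> embedding u w')"
  by (simp add: matched_def)

lemma factor_lang_iff: "w \<in> factor_lang u \<longleftrightarrow> (\<exists>v w' v'. w = v @ w' @ v' \<and> embedding u w')"
  by (auto simp: factor_lang_def gfactor_le_def sublist_def)

text \<open>An embedding either leaves \<open>a\<close> outside, hence lies in \<open>w\<close>, or
  ends at the right end, which \<open>matched\<close> records.\<close>

lemma factor_lang_snoc:
  "w @ [a] \<in> factor_lang u \<longleftrightarrow> w \<in> factor_lang u \<or> length u \<in> matched u (w @ [a])"
proof
  assume "w @ [a] \<in> factor_lang u"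
  then obtain v w' v' where *: "w @ [a] = v @ w' @ v'" "embedding u w'"
    unfolding factor_lang_iff by blast
  then show "w \<in> factor_lang u \<or> length u \<in> matched u (w @ [a])"
    unfolding factor_lang_iff length_in_matched by (cases v' rule: rev_cases) auto
next
  assume "w \<in> factor_lang u \<or> length u \<in> matched u (w @ [a])"
  then show "w @ [a] \<in> factor_lang u"
    unfolding factor_lang_iff length_in_matched by (metis append.assoc append_Nil2)
qed

text \<open>An embedding that stops before the right end already lies in \<open>w\<close>.
  Membership thus means that \<open>u\<close> occurs for the first time on reading
  \<open>a\<close>.\<close>

lemma suffix_lang_snoc:
  "w @ [a] \<in> suffix_lang u \<longleftrightarrow> w @ [a] \<in> factor_lang u \<and> w \<notin> factor_lang u"
proof -
  have "(\<forall>v w' v'. w @ [a] = v @ w' @ v' \<and> embedding u w' \<longrightarrow> v' = []) \<longleftrightarrow> w \<notin> factor_lang u"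
    (is "?L \<longleftrightarrow> _")
  proof
    assume L: ?L
    show "w \<notin> factor_lang u"
    proof
      assume "w \<in> factor_lang u"
      then obtain v w' v' where "w = v @ w' @ v'" "embedding u w'"
        unfolding factor_lang_iff by blast
      with L[rule_format, of v w' "v' @ [a]"] show False by simp
    qed
  next
    assume nin: "w \<notin> factor_lang u"
    show ?L
    proof (intro allI impI)
      fix v w' v' assume *: "w @ [a] = v @ w' @ v' \<and> embedding u w'"
      with nin show "v' = []"
        unfolding factor_lang_iff by (cases v' rule: rev_cases) auto
    qed
  qed
  then show ?thesis
    by (auto simp: suffix_lang_def)
qed

theorem theorem8p2:
  fixes wt :: "'p::order \<Rightarrow> ('v::finite, int) mps" and u :: "'p list"
  assumes "regular_weight wt"
    and "mps_summable (word_weight wt) UNIV"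
    and "\<And>y z. subseq y u \<Longrightarrow> subseq z u \<Longrightarrow>
      mps_rational (mps_sum wt {a. (\<forall>b\<in>set y. b \<le> a) \<and> (\<forall>b\<in>set z. \<not> b \<le> a)})"
  shows "mps_rational (factor_gf wt u) \<and> mps_rational (suffix_gf wt u) \<and> mps_rational (avoid_gf wt u)"
proof -
  define n where "n = length u"
  define ty where "ty a = {j. j < n \<and> u ! j \<le> a}" for a
  define st where "st w = (matched u w, w \<in> factor_lang u, w \<in> suffix_lang u)" for w
  \<comment> \<open>The bit \<open>f\<close> remembers whether \<open>u\<close> has occurred so far;
    the suffix bit is set exactly when \<open>f\<close> switches from false to true.\<close>
  define \<delta> :: "nat set \<times> bool \<times> bool \<Rightarrow> nat set \<Rightarrow> nat set \<times> bool \<times> bool"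
    where "\<delta> = (\<lambda>(M, f, s) t. let M' = insert 0 (Suc ` (M \<inter> t)); f' = (f \<or> n \<in> M')
      in (M', f', f' \<and> \<not> f))"
  have rational: "mps_rational (mps_sum wt {a. ty a = t})" if "t \<in> Pow {..<n}" for t
  proof -
    \<comment> \<open>The subwords \<open>y\<close> and \<open>z\<close> of the hypothesis are the
      letters of \<open>u\<close> at positions inside and outside \<open>t\<close>. If equal letters
      fall on both sides, both sets are empty.\<close>
    have "{a. ty a = t}
        = {a. (\<forall>b\<in>set (nths u t). b \<le> a) \<and> (\<forall>b\<in>set (nths u (- t)). \<not> b \<le> a)}"
      using that by (fastforce simp: ty_def n_def set_nths)
    then show ?thesis
      using assms(3)[of "nths u t" "nths u (- t)"] by (simp add: subseq_conv_nths) blast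
  qed
  have automaton: "mps_rational (mps_sum (word_weight wt) {w. R (st w)})" for R
  proof (rule mps_rational_automaton[where Q = "Pow {..n} \<times> UNIV \<times> UNIV" and T = "Pow {..<n}"
        and ty = ty and \<delta> = \<delta>])
    show "st (w @ [a]) = \<delta> (st w) (ty a)" for w a
      by (simp add: st_def \<delta>_def Let_def factor_lang_snoc suffix_lang_snoc matched_snoc
          ty_def n_def)
    show "st w \<in> Pow {..n} \<times> UNIV \<times> UNIV" for w
      by (auto simp: st_def matched_def n_def)
    show "ty a \<in> Pow {..<n}" for a
      by (auto simp: ty_def)
  qed (use assms(2) rational in auto)
  \<comment> \<open>One automaton serves all three languages; only the accepting states
    differ.\<close>
  show ?thesis
    using automaton[of "\<lambda>(M, f, s). f"] automaton[of "\<lambda>(M, f, s). s"]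
      automaton[of "\<lambda>(M, f, s). \<not> f"]
    by (simp add: st_def factor_gf_def suffix_gf_def avoid_gf_def avoid_lang_def factor_lang_def)
qed

end
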